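(* Let $F:\mathbb{R}^2\times\mathbb{R}\to\mathbb{R}$, $(x,y,\alpha)\mapsto F(x,y,\alpha)$, be of class $\mathcal{C}^1$, and let $f:U\to\mathbb{R}$ be of class $\mathcal{C}^1$ on an open set $U\subset\mathbb{R}^2$ with $F(x,f(x,\alpha),\alpha)=0$ for all $(x,\alpha)\in U$. Fix $\alpha$ and let $x_0$ be a periodic point of $f(\cdot,\alpha)$ of period $p\ge 1$, with orbit $x_{i+1}=f(x_i,\alpha)$, $(x_i,\alpha)\in U$ for $0\le i\le p-1$, and $x_p=x_0$ (so $F(x_i,x_{i+1},\alpha)=0$ for $0\le i\le p-1$). Assume $F_y(x_i,x_{i+1},\alpha)\ne 0$ for $0\le i\le p-1$. Then $$\partial_x f^{p}(x_0,\alpha)=\prod_{j=0}^{p-1} f_x(x_j,\alpha)=(-1)^p\prod_{j=0}^{p-1}\frac{F_x(x_j,x_{j+1\,(\mathrm{mod}\ p)},\alpha)}{F_y(x_j,x_{j+1\,(\mathrm{mod}\ p)},\alpha)} .$$ Consequently, for each sign $\varepsilon\in\{1,-1\}$, the non-hyperbolicity condition $\partial_x f^{p}(x_0,\alpha)=\varepsilon$ is equivalent to the bifurcation equation $$(-1)^p\prod_{j=0}^{p-1}\frac{F_x(x_j,x_{j+1\,(\mathrm{mod}\ p)},\alpha)}{F_y(x_j,x_{j+1\,(\mathrm{mod}\ p)},\alpha)}=\varepsilon .$$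
   Context: The equation $F(x_n,x_{n+1},\alpha)=0$ defines implicitly a one-dimensional discrete dynamical system $x_{n+1}=f(x_n,\alpha)$, where $\alpha$ is a real parameter. $f^{i}$ denotes the $i$-fold composition of $f$ in the dynamic variable with the parameter fixed: $f^{0}(x,\alpha)=x$, $f^{i+1}(x,\alpha)=f(f^{i}(x,\alpha),\alpha)$. $F_x$, $F_y$ denote the partial derivatives of $F$ with respect to its first and second arguments, $f_x$ that of $f$ with respect to its first argument, and $\partial_x f^{p}$ is the partial derivative of $(x,\alpha)\mapsto f^{p}(x,\alpha)$ with respect to $x$. A periodic point of period $p$ is non-hyperbolic if $|\partial_x f^p(x_0,\alpha)|=1$. *)

theory Defs
  imports "HOL-Analysis.Analysis"
begin

text \<open>Class \<open>C\<^sup>1\<close>, intended for open \<open>S\<close> only: Frechet differentiable at every point, with a derivative that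
  is continuous in the operator norm. (The library's \<open>C1_differentiable_on\<close> only covers functions
  of one real variable.)\<close>

definition C1_on :: "('a::real_normed_vector \<Rightarrow> 'b::real_normed_vector) \<Rightarrow> 'a set \<Rightarrow> bool" where
  "C1_on g S \<longleftrightarrow>
    (\<exists>g' :: 'a \<Rightarrow> 'a \<Rightarrow>\<^sub>L 'b.
      (\<forall>z\<in>S. (g has_derivative blinfun_apply (g' z)) (at z)) \<and> continuous_on S g')"

definition F_x :: "(real \<times> real \<times> real \<Rightarrow> real) \<Rightarrow> real \<Rightarrow> real \<Rightarrow> real \<Rightarrow> real" where
  "F_x F x y \<alpha> = deriv (\<lambda>s. F (s, y, \<alpha>)) x"

definition F_y :: "(real \<times> real \<times> real \<Rightarrow> real) \<Rightarrow> real \<Rightarrow> real \<Rightarrow> real \<Rightarrow> real" where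
  "F_y F x y \<alpha> = deriv (\<lambda>s. F (x, s, \<alpha>)) y"

definition f_x :: "(real \<times> real \<Rightarrow> real) \<Rightarrow> real \<Rightarrow> real \<Rightarrow> real" where
  "f_x f x \<alpha> = deriv (\<lambda>s. f (s, \<alpha>)) x"

text \<open>The map \<open>f\<close> is a total HOL function, meaningful only on its domain \<open>U\<close>. If the points
  \<open>(f\<^sup>i(x, \<alpha>), \<alpha>)\<close> with \<open>i < n\<close> lie in the open set \<open>U\<close>, and \<open>f\<close> is continuous there, the same holds
  for all starting points near \<open>x\<close>, so the germ of \<open>iter f n\<close> at \<open>x\<close>, hence its derivative, does not
  depend on the values of \<open>f\<close> outside \<open>U\<close>.\<close>

primrec iter :: "(real \<times> real \<Rightarrow> real) \<Rightarrow> nat \<Rightarrow> real \<Rightarrow> real \<Rightarrow> real" where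
  "iter f 0 x \<alpha> = x"
| "iter f (Suc i) x \<alpha> = f (iter f i x \<alpha>, \<alpha>)"

definition iter_x :: "(real \<times> real \<Rightarrow> real) \<Rightarrow> nat \<Rightarrow> real \<Rightarrow> real \<Rightarrow> real" where
  "iter_x f n x \<alpha> = deriv (\<lambda>s. iter f n s \<alpha>) x"

end

theory Submission
  imports Defs
begin

text \<open>Both equalities are instances of the chain rule. Along the orbit, the derivative of the
  \<open>p\<close>-th iterate is the product of the derivatives of the single steps, by induction on the number
  of steps (\<open>iter_has_field_derivative\<close>). Each factor is found by implicit differentiation: the
  function \<open>s \<mapsto> F (s, f (s, \<alpha>), \<alpha>)\<close> vanishes on a neighbourhood of \<open>x\<^sub>j\<close>, because \<open>U\<close> is open, so its
  derivative \<open>F\<^sub>x + F\<^sub>y f\<^sub>x\<close> vanishes at \<open>x\<^sub>j\<close>, and \<open>f\<^sub>x = - F\<^sub>x / F\<^sub>y\<close> there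
  (\<open>implicit_derivative\<close>). Multiplying over the orbit collects the signs into \<open>(-1)\<^sup>p\<close>. Periodicity
  identifies \<open>x\<^sub>p\<close> with \<open>x\<^sub>0\<close>, which is what reducing the index \<open>j + 1\<close> modulo \<open>p\<close> expresses.\<close>

lemma C1_on_imp_differentiable:
  assumes "C1_on g S" "z \<in> S"
  shows "g differentiable (at z)"
  using assms unfolding C1_on_def differentiable_def by blast

lemma f_x_has_field_derivative:
  assumes "f differentiable (at (s, a))"
  shows "((\<lambda>t. f (t, a)) has_field_derivative f_x f s a) (at s)"
proof -
  have "(\<lambda>t. (t, a)) differentiable (at s)"
    unfolding differentiable_def by (auto intro!: derivative_eq_intros)
  with assms have "(f \<circ> (\<lambda>t. (t, a))) differentiable (at s)"
    by (intro differentiable_chain_at) auto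
  then show ?thesis
    by (simp add: o_def f_x_def DERIV_deriv_iff_real_differentiable)
qed

text \<open>Restricting \<open>F\<close> to a coordinate line identifies the value of \<open>D\<close> on the corresponding basis
  vector with a partial derivative, and linearity does the rest. The third component is \<open>0\<close> because
  the parameter stays fixed.\<close>

lemma has_derivative_partials:
  assumes D: "(F has_derivative D) (at (x, y, a))"
  shows "D (h, k, 0) = F_x F x y a * h + F_y F x y a * k"
proof -
  interpret D: bounded_linear D
    using D by (rule has_derivative_bounded_linear)
  have "((\<lambda>s. F (s, y, a)) has_derivative (\<lambda>h. D (h, 0, 0))) (at x)"
    by (rule has_derivative_compose[of "\<lambda>s. (s, y, a)"])
      (auto intro!: derivative_eq_intros D simp: zero_prod_def)
  moreover have "(\<lambda>h. D (h, 0, 0)) = (*) (D (1, 0, 0))"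
  proof
    fix h
    have "D (h, 0, 0) = D (h *\<^sub>R (1, 0, 0))"
      by simp
    also have "\<dots> = D (1, 0, 0) * h"
      by (simp only: D.scaleR real_scaleR_def mult.commute)
    finally show "D (h, 0, 0) = D (1, 0, 0) * h" .
  qed
  ultimately have Fx: "F_x F x y a = D (1, 0, 0)"
    unfolding F_x_def by (intro DERIV_imp_deriv) (simp only: has_field_derivative_def)
  have "((\<lambda>s. F (x, s, a)) has_derivative (\<lambda>h. D (0, h, 0))) (at y)"
    by (rule has_derivative_compose[of "\<lambda>s. (x, s, a)"])
      (auto intro!: derivative_eq_intros D simp: zero_prod_def)
  moreover have "(\<lambda>h. D (0, h, 0)) = (*) (D (0, 1, 0))"
  proof
    fix h
    have "D (0, h, 0) = D (h *\<^sub>R (0, 1, 0))"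
      by simp
    also have "\<dots> = D (0, 1, 0) * h"
      by (simp only: D.scaleR real_scaleR_def mult.commute)
    finally show "D (0, h, 0) = D (0, 1, 0) * h" .
  qed
  ultimately have Fy: "F_y F x y a = D (0, 1, 0)"
    unfolding F_y_def by (intro DERIV_imp_deriv) (simp only: has_field_derivative_def)
  have "D (h, k, 0) = D (h *\<^sub>R (1, 0, 0) + k *\<^sub>R (0, 1, 0))"
    by simp
  also have "\<dots> = h *\<^sub>R D (1, 0, 0) + k *\<^sub>R D (0, 1, 0)"
    by (simp only: D.add D.scaleR)
  finally show ?thesis
    by (simp add: Fx Fy mult.commute)
qed

text \<open>Implicit differentiation. That \<open>F\<close> vanishes along the graph of \<open>f\<close> near the point makes the
  composite locally constant; its chain-rule derivative must then agree with \<open>0\<close>.\<close>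

lemma implicit_derivative:
  assumes F: "F differentiable (at (s, f (s, a), a))"
    and f: "f differentiable (at (s, a))"
    and U: "open U" "(s, a) \<in> U"
    and zero: "\<And>t b. (t, b) \<in> U \<Longrightarrow> F (t, f (t, b), b) = 0"
    and nz: "F_y F s (f (s, a)) a \<noteq> 0"
  shows "f_x f s a = - (F_x F s (f (s, a)) a / F_y F s (f (s, a)) a)"
proof -
  obtain D where D: "(F has_derivative D) (at (s, f (s, a), a))"
    using F unfolding differentiable_def by blast
  have f': "((\<lambda>t. f (t, a)) has_derivative (\<lambda>h. f_x f s a * h)) (at s)"
    using f_x_has_field_derivative[OF f] by (simp add: has_field_derivative_def)
  have "((\<lambda>t. F (t, f (t, a), a)) has_derivative (\<lambda>h. D (h, f_x f s a * h, 0))) (at s)"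
    by (rule has_derivative_compose[of "\<lambda>t. (t, f (t, a), a)"])
      (auto intro!: derivative_eq_intros D f')
  moreover have "((\<lambda>t. F (t, f (t, a), a)) has_derivative (\<lambda>h. 0)) (at s)"
  proof (rule has_derivative_transform_within_open)
    show "((\<lambda>t. 0) has_derivative (\<lambda>h. 0)) (at s)"
      by simp
    show "open ((\<lambda>t. (t, a)) -` U)"
      using U(1) by (rule open_vimage) (intro continuous_intros)
  qed (use U(2) zero in auto)
  ultimately have "(\<lambda>h. D (h, f_x f s a * h, 0)) = (\<lambda>h. 0)"
    by (rule has_derivative_unique)
  then have "D (1, f_x f s a * 1, 0) = 0"
    by (rule fun_cong)
  then have "F_x F s (f (s, a)) a + F_y F s (f (s, a)) a * f_x f s a = 0"
    by (simp add: has_derivative_partials[OF D])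
  with nz show ?thesis
    by (simp add: field_simps add_eq_0_iff)
qed

lemma iter_orbit:
  assumes "\<And>i. i < n \<Longrightarrow> x (Suc i) = f (x i, a)"
  shows "iter f n (x 0) a = x n"
  using assms by (induction n) auto

lemma iter_has_field_derivative:
  assumes "\<And>i. i < n \<Longrightarrow> x (Suc i) = f (x i, a)"
    and "\<And>i. i < n \<Longrightarrow> f differentiable (at (x i, a))"
  shows "((\<lambda>s. iter f n s a) has_field_derivative (\<Prod>j<n. f_x f (x j) a)) (at (x 0))"
  using assms
proof (induction n)
  case 0
  then show ?case by simp
next
  case (Suc n)
  have "iter f n (x 0) a = x n"
    using Suc.prems(1) by (intro iter_orbit) simp
  then have step: "((\<lambda>t. f (t, a)) has_field_derivative f_x f (x n) a) (at (iter f n (x 0) a))"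
    using Suc.prems(2)[of n] by (simp add: f_x_has_field_derivative)
  have "((\<lambda>s. iter f n s a) has_field_derivative (\<Prod>j<n. f_x f (x j) a)) (at (x 0))"
    using Suc by simp
  from DERIV_chain2[OF step this] show ?case
    by (simp add: mult.commute)
qed

theorem corollary3p2:
  fixes F :: "real \<times> real \<times> real \<Rightarrow> real"
    and f :: "real \<times> real \<Rightarrow> real"
    and U :: "(real \<times> real) set"
    and \<alpha> :: real
    and x :: "nat \<Rightarrow> real"
    and p :: nat
  assumes F_C1: "C1_on F UNIV"
    and U_open: "open U"
    and f_C1: "C1_on f U"
    and implicit: "\<And>s a. (s, a) \<in> U \<Longrightarrow> F (s, f (s, a), a) = 0"
    and p_pos: "p \<ge> 1"
    and orbit: "\<And>i. i < p \<Longrightarrow> x (Suc i) = f (x i, \<alpha>)"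
    and orbit_in_U: "\<And>i. i < p \<Longrightarrow> (x i, \<alpha>) \<in> U"
    and periodic: "x p = x 0"
    and F_y_nonzero: "\<And>i. i < p \<Longrightarrow> F_y F (x i) (x (Suc i)) \<alpha> \<noteq> 0"
  shows "(\<lambda>s. iter f p s \<alpha>) field_differentiable at (x 0)
    \<and> iter_x f p (x 0) \<alpha> = (\<Prod>j<p. f_x f (x j) \<alpha>)
    \<and> (\<Prod>j<p. f_x f (x j) \<alpha>)
      = (-1) ^ p * (\<Prod>j<p. F_x F (x j) (x (Suc j mod p)) \<alpha> / F_y F (x j) (x (Suc j mod p)) \<alpha>)
    \<and> (\<forall>\<epsilon>\<in>{1, -1}. iter_x f p (x 0) \<alpha> = \<epsilon> \<longleftrightarrow>
      (-1) ^ p * (\<Prod>j<p. F_x F (x j) (x (Suc j mod p)) \<alpha> / F_y F (x j) (x (Suc j mod p)) \<alpha>) = \<epsilon>)"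
proof -
  have f_diff: "f differentiable (at (x i, \<alpha>))" if "i < p" for i
    using C1_on_imp_differentiable[OF f_C1 orbit_in_U[OF that]] .
  have deriv_iter: "((\<lambda>s. iter f p s \<alpha>) has_field_derivative (\<Prod>j<p. f_x f (x j) \<alpha>)) (at (x 0))"
    using orbit f_diff by (rule iter_has_field_derivative)
  then have iter_x_eq: "iter_x f p (x 0) \<alpha> = (\<Prod>j<p. f_x f (x j) \<alpha>)"
    unfolding iter_x_def by (rule DERIV_imp_deriv)
  have factor: "f_x f (x j) \<alpha>
      = - (F_x F (x j) (x (Suc j mod p)) \<alpha> / F_y F (x j) (x (Suc j mod p)) \<alpha>)" if "j < p" for j
  proof -
    have "x (Suc j mod p) = x (Suc j)"
      using that periodic by (cases "Suc j = p") auto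
    then show ?thesis
      using implicit_derivative[OF C1_on_imp_differentiable[OF F_C1 UNIV_I] f_diff[OF that]
          U_open orbit_in_U[OF that] implicit] F_y_nonzero[OF that]
      by (simp add: orbit[OF that])
  qed
  have prod_eq: "(\<Prod>j<p. f_x f (x j) \<alpha>)
      = (-1) ^ p * (\<Prod>j<p. F_x F (x j) (x (Suc j mod p)) \<alpha> / F_y F (x j) (x (Suc j mod p)) \<alpha>)"
    using prod_uminus[of "\<lambda>j. F_x F (x j) (x (Suc j mod p)) \<alpha> / F_y F (x j) (x (Suc j mod p)) \<alpha>"
        "{..<p}"] factor
    by simp
  show ?thesis
    using deriv_iter unfolding iter_x_eq prod_eq field_differentiable_def by blast
qed

end
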